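(* Let $d\in\mathbb{N}$, $d\ge 1$. If $X$ is a $d$-dimensional real normed space with $d_{\mathrm{BM}}(X,\ell_\infty^d)<3/2$, then $m(X)\leq d+1$. In addition, $m(\ell_\infty^d)=d+1$.
   Context: All vector spaces are over $\mathbb{R}$. $\ell_\infty^d$ is $\mathbb{R}^d$ with the norm $\|x\|_\infty=\max_{1\le n\le d}|x^{(n)}|$. For two normed spaces $X,Y$ of the same finite dimension, the (multiplicative) Banach-Mazur distance $d_{\mathrm{BM}}(X,Y)$ is the infimum of all $c\geq 1$ such that $\|x\|_X\leq\|Tx\|_Y\leq c\|x\|_X$ for all $x\in X$, for some invertible linear transformation $T\colon X\to Y$. A subset $A$ of a normed space $X$ is $\lambda$-equilateral if $\|x-y\|=\lambda$ for all distinct $x,y\in A$; $A$ is equilateral if it is $\lambda$-equilateral for some $\lambda>0$. An equilateral set $A\subseteq X$ is maximal if there is no equilateral set $A'\subseteq X$ with $A\subsetneq A'$. $m(X)$ denotes the minimum cardinality of a maximal equilateral set in $X$. *)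

theory Defs
  imports "HOL-Analysis.Analysis"
begin

text \<open>
  Several norms are considered on the same vector space (the type \<^typ>\<open>real ^ 'n\<close> carries the
  Euclidean norm as its class instance), so a normed space is given by a real vector space type
  together with an explicit norm function.  The space \<open>\<ell>\<^sub>\<infinity>\<^sup>d\<close> is \<^typ>\<open>real ^ 'n\<close> with
  \<open>CARD('n) = d\<close> and the library's \<^const>\<open>infnorm\<close>.
\<close>

definition is_norm :: "('a::real_vector \<Rightarrow> real) \<Rightarrow> bool" where
  "is_norm N \<longleftrightarrow>
     (\<forall>x. N x = 0 \<longleftrightarrow> x = 0) \<and>
     (\<forall>c x. N (c *\<^sub>R x) = \<bar>c\<bar> * N x) \<and>
     (\<forall>x y. N (x + y) \<le> N x + N y)"

lemma is_norm_norm: "is_norm (norm :: 'a::real_normed_vector \<Rightarrow> real)"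
  by (simp add: is_norm_def norm_triangle_ineq)

lemma is_norm_infnorm: "is_norm (infnorm :: 'a::euclidean_space \<Rightarrow> real)"
  by (simp add: is_norm_def infnorm_eq_0 infnorm_mul infnorm_triangle)

lemma infnorm_eq_Max_coordinates:
  "infnorm (x :: real ^ 'n) = Max (range (\<lambda>i. \<bar>x $ i\<bar>))"
proof -
  have "{\<bar>x $ i\<bar> |i. i \<in> UNIV} = range (\<lambda>i. \<bar>x $ i\<bar>)"
    by auto
  then show ?thesis
    by (simp add: infnorm_cart cSup_eq_Max)
qed

text \<open>
  Meaningful only for spaces of the same finite dimension, where the set below is nonempty.
\<close>

definition banach_mazur_dist ::
    "('a::real_vector \<Rightarrow> real) \<Rightarrow> ('b::real_vector \<Rightarrow> real) \<Rightarrow> real" where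
  "banach_mazur_dist N M =
     Inf {c. c \<ge> 1 \<and> (\<exists>T. linear T \<and> bij T \<and> (\<forall>x. N x \<le> M (T x) \<and> M (T x) \<le> c * N x))}"

definition equilateral_with :: "('a::real_vector \<Rightarrow> real) \<Rightarrow> real \<Rightarrow> 'a set \<Rightarrow> bool" where
  "equilateral_with N l A \<longleftrightarrow> (\<forall>x\<in>A. \<forall>y\<in>A. x \<noteq> y \<longrightarrow> N (x - y) = l)"

definition equilateral :: "('a::real_vector \<Rightarrow> real) \<Rightarrow> 'a set \<Rightarrow> bool" where
  "equilateral N A \<longleftrightarrow> (\<exists>l>0. equilateral_with N l A)"

definition maximal_equilateral :: "('a::real_vector \<Rightarrow> real) \<Rightarrow> 'a set \<Rightarrow> bool" where
  "maximal_equilateral N A \<longleftrightarrow> equilateral N A \<and> \<not> (\<exists>A'. equilateral N A' \<and> A \<subset> A')"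

text \<open>
  In a finite-dimensional normed space every equilateral set is finite; \<^const>\<open>finite\<close> is required
  here because \<^const>\<open>card\<close> is \<open>0\<close> on infinite sets.
\<close>

definition min_maximal_equilateral :: "('a::real_vector \<Rightarrow> real) \<Rightarrow> nat" where
  "min_maximal_equilateral N =
     (LEAST k. \<exists>A. maximal_equilateral N A \<and> finite A \<and> card A = k)"

end

theory Submission
  imports Defs
begin

text \<open>
  Upper bound.  In \<open>\<ell>\<^sub>\<infinity>\<^sup>d\<close> consider points \<open>p\<^sub>1, \<dots>, p\<^sub>d\<^sub>+\<^sub>1\<close>, where \<open>p\<^sub>j\<close> has coordinate \<open>-1\<close> at place
  \<open>j\<close>, \<open>-1/2\<close> after it, and small nonnegative numbers \<open>\<epsilon>\<^sub>k\<^sub>j\<close> at the places \<open>k < j\<close>.  For \<open>k < j\<close> the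
  distance from \<open>p\<^sub>k\<close> to \<open>p\<^sub>j\<close> is exactly \<open>1 + \<epsilon>\<^sub>k\<^sub>j\<close>, so each distance has its own parameter.
  Let \<open>N\<close> be a norm with \<open>N \<le> \<parallel>\<cdot>\<parallel>\<^sub>\<infinity> \<le> (1 + b) N\<close>.  Then \<open>\<epsilon>\<^sub>k\<^sub>j \<mapsto> 1 + \<epsilon>\<^sub>k\<^sub>j - N (p\<^sub>k - p\<^sub>j)\<close> maps the cube
  \<open>[0, b]\<close> to the power of the pairs into itself, and a fixed point, which Brouwer's theorem
  provides, makes all \<open>N\<close>-distances equal to \<open>1\<close> (\<open>equilateral_perturbed_simplex_exists\<close>).

  If \<open>b < 1/2\<close>, no further point \<open>x\<close> can have \<open>N\<close>-distance \<open>1\<close> to all the \<open>p\<^sub>j\<close>.  Its sup distances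
  would lie between \<open>1\<close> and \<open>1 + b\<close>, so each \<open>p\<^sub>j\<close> would have a coordinate in which \<open>x\<close> is at least \<open>1\<close>
  away.  For \<open>p\<^sub>1\<close> this can only be the first one, which forces \<open>x\<^sub>1 \<ge> 0\<close>; a coordinate with
  \<open>x\<^sub>k \<ge> 0\<close> is of no use to the later points, so \<open>p\<^sub>2\<close> needs the second coordinate, and so on, until
  nothing is left for \<open>p\<^sub>d\<^sub>+\<^sub>1\<close> (\<open>perturbed_simplex_not_extendable\<close>).

  Lower bound.  Let \<open>A\<close> be a maximal equilateral set with common distance \<open>l\<close> in
  \<open>\<ell>\<^sub>\<infinity>\<^sup>d\<close>.  In every coordinate, \<open>A\<close> spans an interval of length at most
  \<open>l\<close>.  Choose a sign for every coordinate and let \<open>x\<close> have the coordinate \<open>min + l\<close> or \<open>max - l\<close>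
  accordingly.  Then \<open>x\<close> is within distance \<open>l\<close> of all of \<open>A\<close>, so by maximality it is at distance less
  than \<open>l\<close> from some point; that point is unique, as any two points of \<open>A\<close> are the minimum and the maximum
  of \<open>A\<close> in some coordinate.  The points of \<open>A\<close> thus partition the \<open>2\<^sup>d\<close> sign choices into subcubes
  such that every coordinate is constrained by some subcube.  Such a partition has more than \<open>d\<close>
  parts (\<open>card_gt_of_sign_partition\<close>), by a linear algebra argument.
\<close>

section \<open>Norms on coordinate space\<close>

lemma infnorm_cart_le_iff:
  "infnorm (x :: real ^ 'n) \<le> b \<longleftrightarrow> (\<forall>k. \<bar>x $ k\<bar> \<le> b)"
  by (auto simp: infnorm_eq_Max_coordinates)

lemma infnorm_cart_ge_iff:
  "b \<le> infnorm (x :: real ^ 'n) \<longleftrightarrow> (\<exists>k. b \<le> \<bar>x $ k\<bar>)"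
  by (auto simp: infnorm_eq_Max_coordinates Max_ge_iff)

lemma is_normD:
  assumes "is_norm N"
  shows "N x = 0 \<longleftrightarrow> x = 0" "N (c *\<^sub>R x) = \<bar>c\<bar> * N x" "N (x + y) \<le> N x + N y"
  using assms by (auto simp: is_norm_def)

lemma is_norm_minus_commute:
  assumes "is_norm N"
  shows "N (x - y) = N (y - x)"
  using is_normD(2)[OF assms, of "-1" "x - y"] by simp

lemma is_norm_nonneg:
  assumes "is_norm N"
  shows "0 \<le> N x"
  using is_normD(3)[OF assms, of x "- x"] is_normD(1)[OF assms, of 0]
    is_normD(2)[OF assms, of "-1" x] by simp

lemma is_norm_pullback:
  assumes "is_norm N" "linear f" "inj f"
  shows "is_norm (\<lambda>x. N (f x))"
  using assms linear_injective_0[OF assms(2)]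
  by (auto simp: is_norm_def linear_add linear_scale linear_0)

lemma is_norm_continuous_on:
  fixes N :: "real ^ 'n \<Rightarrow> real"
  assumes N: "is_norm N" and C: "\<And>x. N x \<le> C * infnorm x"
  shows "continuous_on S N"
proof -
  have "\<bar>N x - N y\<bar> \<le> \<bar>C\<bar> * norm (x - y)" for x y
  proof -
    have "N x \<le> N (x - y) + N y" "N y \<le> N (y - x) + N x"
      using is_normD(3)[OF N, of "x - y" y] is_normD(3)[OF N, of "y - x" x] by auto
    then have "\<bar>N x - N y\<bar> \<le> N (x - y)"
      using is_norm_minus_commute[OF N, of x y] by linarith
    also have "\<dots> \<le> \<bar>C\<bar> * infnorm (x - y)"
      using C[of "x - y"] infnorm_pos_le[of "x - y"]
      by (meson abs_ge_self mult_right_mono order_trans)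
    also have "\<dots> \<le> \<bar>C\<bar> * norm (x - y)"
      using infnorm_le_norm[of "x - y"] by (simp add: mult_left_mono)
    finally show ?thesis .
  qed
  then have "\<bar>C\<bar>-lipschitz_on S N"
    by (auto simp: lipschitz_on_def dist_real_def dist_norm)
  then show ?thesis
    by (rule lipschitz_on_continuous_on)
qed

section \<open>A simplex in the sup norm with adjustable distances\<close>

text \<open>
  The vertices are indexed by the coordinates and one extra element \<^const>\<open>None\<close>; the injection \<open>r\<close> orders
  them, with \<^const>\<open>None\<close> last.  The matrix \<open>\<epsilon>\<close> has an entry for every pair \<open>k\<close>, \<open>j\<close>, so that it lives in a
  Euclidean space, but only the entries with \<open>k\<close> before \<open>j\<close> enter.

  The value \<open>-1/2\<close> is what makes the simplex maximal.  With \<open>0\<close> in its place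
  the distances would be the same, but the point with all coordinates \<open>-1\<close> could be added for
  \<open>\<epsilon> = 0\<close> and \<open>d \<ge> 2\<close>.
\<close>

definition perturbed_simplex ::
    "('n option \<Rightarrow> nat) \<Rightarrow> real ^ ('n option) ^ 'n \<Rightarrow> 'n option \<Rightarrow> real ^ 'n" where
  "perturbed_simplex r \<epsilon> j =
     (\<chi> k. if r j < r (Some k) then - 1 / 2 else if j = Some k then - 1 else \<epsilon> $ k $ j)"

text \<open>
  The distance is attained in coordinate \<open>k\<close>, where the points have the values \<open>-1\<close> and \<open>\<epsilon> $ k $ j\<close>.  In any
  other coordinate the first point has a value in \<open>[-1/2, 1/2]\<close> and the second one in \<open>[-1, 1/2]\<close>,
  and a gap above \<open>1\<close> would require \<open>-1\<close> against a positive value.  Only in coordinate \<open>j\<close> is the second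
  value \<open>-1\<close>, and there the first one is \<open>-1/2\<close>.
\<close>

lemma infnorm_perturbed_simplex_diff:
  fixes \<epsilon> :: "real ^ ('n::finite option) ^ 'n"
  assumes r: "inj r" and less: "r (Some k) < r j"
    and \<epsilon>: "\<And>k j. 0 \<le> \<epsilon> $ k $ j \<and> \<epsilon> $ k $ j \<le> 1 / 2"
  shows "infnorm (perturbed_simplex r \<epsilon> (Some k) - perturbed_simplex r \<epsilon> j) = 1 + \<epsilon> $ k $ j"
    (is "infnorm ?v = _")
proof (rule antisym)
  have "?v $ k = - 1 - \<epsilon> $ k $ j"
    using less by (auto simp: perturbed_simplex_def)
  then have "1 + \<epsilon> $ k $ j \<le> \<bar>?v $ k\<bar>"
    using \<epsilon>[of k j] by simp
  then show "1 + \<epsilon> $ k $ j \<le> infnorm ?v"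
    by (auto simp: infnorm_cart_ge_iff)
  have "\<bar>?v $ l\<bar> \<le> 1 + \<epsilon> $ k $ j" for l
  proof (cases "l = k")
    case True
    then show ?thesis
      using less \<epsilon>[of k j] by (auto simp: perturbed_simplex_def)
  next
    case False
    then have "r (Some k) \<noteq> r (Some l)"
      using r by (auto dest: injD)
    then show ?thesis
      using less \<epsilon>[of k j] \<epsilon>[of l j] \<epsilon>[of l "Some k"] False
      by (auto simp: perturbed_simplex_def)
  qed
  then show "infnorm ?v \<le> 1 + \<epsilon> $ k $ j"
    by (simp add: infnorm_cart_le_iff)
qed

text \<open>
  If \<open>v\<close> is the difference of two vertices, then \<open>0 \<le> \<parallel>v\<parallel>\<^sub>\<infinity> - N v\<close> and
  \<open>\<parallel>v\<parallel>\<^sub>\<infinity> - N v \<le> b / (1 + b) * \<parallel>v\<parallel>\<^sub>\<infinity> \<le> b\<close>.  So the error made by measuring \<open>v\<close> with \<open>N\<close> instead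
  of the sup norm is itself an admissible value of the parameter, and Brouwer's theorem finds
  parameters that equal their own errors.
\<close>

lemma equilateral_perturbed_simplex_exists:
  fixes N :: "real ^ 'n::finite \<Rightarrow> real"
  assumes N: "is_norm N" and b: "0 \<le> b" "b \<le> 1 / 2"
    and upper: "\<And>x. N x \<le> infnorm x" and lower: "\<And>x. infnorm x \<le> (1 + b) * N x"
    and r: "inj r" and last: "\<And>k. r (Some k) < r None"
  obtains \<epsilon> :: "real ^ ('n option) ^ 'n" where
    "\<And>k j. 0 \<le> \<epsilon> $ k $ j \<and> \<epsilon> $ k $ j \<le> b"
    "\<And>i j. i \<noteq> j \<Longrightarrow> N (perturbed_simplex r \<epsilon> i - perturbed_simplex r \<epsilon> j) = 1"
proof -
  define B where "B = {\<epsilon> :: real ^ ('n option) ^ 'n. \<forall>k j. 0 \<le> \<epsilon> $ k $ j \<and> \<epsilon> $ k $ j \<le> b}"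
  define p where "p = perturbed_simplex r"
  define f :: "real ^ ('n option) ^ 'n \<Rightarrow> real ^ ('n option) ^ 'n" where
    "f = (\<lambda>\<epsilon>. \<chi> k j. if r (Some k) < r j then 1 + \<epsilon> $ k $ j - N (p \<epsilon> (Some k) - p \<epsilon> j) else 0)"
  define u :: "real ^ ('n option) ^ 'n" where "u = (\<chi> k j. b)"
  have B_eq: "B = cbox 0 u"
    by (auto simp: B_def u_def cbox_interval less_eq_vec_def)
  have contp: "continuous_on B (\<lambda>\<epsilon>. p \<epsilon> j)" for j
  proof -
    have "continuous_on B (\<lambda>\<epsilon> :: real ^ ('n option) ^ 'n.
        if r j < r (Some k) then - 1 / 2 else if j = Some k then - 1 else \<epsilon> $ k $ j)" for k
      by (cases "r j < r (Some k)"; cases "j = Some k") (simp_all add: continuous_intros)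
    then show ?thesis
      unfolding p_def perturbed_simplex_def by (intro continuous_on_vec_lambda)
  qed
  have "continuous_on UNIV N"
    using is_norm_continuous_on[OF N, of 1] upper by simp
  then have contN: "continuous_on B (\<lambda>\<epsilon>. N (p \<epsilon> i - p \<epsilon> j))" for i j
    by (rule continuous_on_compose2[OF _ continuous_on_diff[OF contp contp]]) auto
  \<comment> \<open>The conditions in \<open>p\<close> and \<open>f\<close> do not involve \<open>\<epsilon>\<close>, so each entry is continuous.\<close>
  have "continuous_on B (\<lambda>\<epsilon>. if r (Some k) < r j then 1 + \<epsilon> $ k $ j - N (p \<epsilon> (Some k) - p \<epsilon> j) else 0)"
    for k j
    by (cases "r (Some k) < r j") (auto intro!: continuous_intros contN)
  then have "continuous_on B f"
    unfolding f_def by (intro continuous_on_vec_lambda)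
  moreover have "f \<in> B \<rightarrow> B"
  proof
    fix \<epsilon> assume "\<epsilon> \<in> B"
    then have \<epsilon>: "0 \<le> \<epsilon> $ k $ j" "\<epsilon> $ k $ j \<le> b" for k j
      by (auto simp: B_def)
    have "0 \<le> f \<epsilon> $ k $ j \<and> f \<epsilon> $ k $ j \<le> b" for k j
    proof (cases "r (Some k) < r j")
      case True
      define v where "v = p \<epsilon> (Some k) - p \<epsilon> j"
      have inf: "infnorm v = 1 + \<epsilon> $ k $ j"
        unfolding v_def p_def
        by (rule infnorm_perturbed_simplex_diff[OF r True])
          (intro conjI \<epsilon>(1) order_trans[OF \<epsilon>(2) b(2)])
      have "(1 + b) * (infnorm v - N v) \<le> b * infnorm v"
        using lower[of v] by (simp add: algebra_simps)
      also have "\<dots> \<le> (1 + b) * b"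
        using inf \<epsilon>[of k j] b mult_left_mono[of "infnorm v" "1 + b" b] by (simp add: mult.commute)
      finally have "infnorm v - N v \<le> b"
        using b by (simp add: mult_le_cancel_left_pos)
      then show ?thesis
        using True upper[of v] inf by (simp add: f_def v_def)
    qed (use b in \<open>simp add: f_def\<close>)
    then show "f \<epsilon> \<in> B"
      by (auto simp: B_def)
  qed
  moreover have "compact B" "convex B"
    by (simp_all add: B_eq compact_cbox convex_box)
  moreover have "0 \<in> B"
    using b by (simp add: B_def)
  ultimately obtain \<epsilon> where \<epsilon>: "\<epsilon> \<in> B" "f \<epsilon> = \<epsilon>"
    using brouwer by blast
  have one: "N (p \<epsilon> (Some k) - p \<epsilon> j) = 1" if "r (Some k) < r j" for k j
  proof -
    have "f \<epsilon> $ k $ j = \<epsilon> $ k $ j"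
      by (simp add: \<epsilon>)
    then show ?thesis
      using that by (simp add: f_def)
  qed
  have unit: "N (p \<epsilon> i - p \<epsilon> j) = 1" if "r i < r j" for i j
    using that last by (cases i; cases j) (auto intro: one dest: less_not_sym)
  show thesis
  proof (rule that)
    show "0 \<le> \<epsilon> $ k $ j \<and> \<epsilon> $ k $ j \<le> b" for k j
      using \<epsilon> by (auto simp: B_def)
    show "N (perturbed_simplex r \<epsilon> i - perturbed_simplex r \<epsilon> j) = 1" if "i \<noteq> j" for i j
    proof -
      have "r i \<noteq> r j"
        using r that by (auto dest: injD)
      then show ?thesis
        using unit[of i j] unit[of j i] is_norm_minus_commute[OF N] unfolding p_def
        by (metis linorder_neqE_nat)
    qed
  qed
qed

text \<open>
  Say that a coordinate \<open>l\<close> serves the vertex \<open>j\<close> if \<open>x\<close> and that vertex differ there by at least \<open>1\<close>; every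
  vertex must be served.  From \<open>- 3 / 2 < x $ l\<close> and \<open>x $ l \<le> b\<close>, where \<open>b < 1 / 2\<close>, the coordinate \<open>l\<close>
  serves no vertex that precedes \<open>l\<close>, as such a vertex has the value \<open>- 1 / 2\<close> there.  It serves the vertex
  \<open>l\<close> only if \<open>0 \<le> x $ l\<close>, and then it serves no later vertex.  Along the order, each vertex \<open>k\<close> is
  therefore served by its own coordinate alone, and the last vertex by none.
\<close>

lemma perturbed_simplex_not_extendable:
  fixes \<epsilon> :: "real ^ ('n::finite option) ^ 'n"
  assumes b: "b < 1 / 2" and \<epsilon>: "\<And>k j. 0 \<le> \<epsilon> $ k $ j \<and> \<epsilon> $ k $ j \<le> b"
    and r: "inj r" and last: "\<And>k. r (Some k) < r None"
    and far: "\<And>j. 1 \<le> infnorm (x - perturbed_simplex r \<epsilon> j)"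
    and near: "\<And>j. infnorm (x - perturbed_simplex r \<epsilon> j) \<le> 1 + b"
  shows False
proof -
  let ?p = "perturbed_simplex r \<epsilon>"
  have near': "\<bar>x $ k - ?p j $ k\<bar> \<le> 1 + b" for k j
    using near[of j] by (auto simp: infnorm_cart_le_iff)
  have le_b: "x $ k \<le> b" for k
    using near'[of k "Some k"] by (simp add: perturbed_simplex_def)
  have gt: "- 3 / 2 < x $ k" for k
  proof -
    have "\<bar>x $ k - \<epsilon> $ k $ None\<bar> \<le> 1 + b"
      using near'[of k None] last[of k] by (simp add: perturbed_simplex_def)
    then show ?thesis
      using \<epsilon>[of k None] b by linarith
  qed
  have covers: "r j \<ge> r (Some l)" if "1 \<le> \<bar>x $ l - ?p j $ l\<bar>" for j l
    using that le_b[of l] gt[of l] b by (auto simp: perturbed_simplex_def split: if_splits)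
  have unused: "\<bar>x $ l - ?p j $ l\<bar> < 1" if "0 \<le> x $ l" "r (Some l) < r j" for j l
    using that le_b[of l] \<epsilon>[of l j] b by (auto simp: perturbed_simplex_def)
  have "0 \<le> x $ k" for k
  proof (induction "r (Some k)" arbitrary: k rule: less_induct)
    case less
    obtain l where l: "1 \<le> \<bar>x $ l - ?p (Some k) $ l\<bar>"
      using far[of "Some k"] by (auto simp: infnorm_cart_ge_iff)
    have "\<not> r (Some l) < r (Some k)"
      using less unused l by force
    then have "r (Some l) = r (Some k)"
      using covers[OF l] by simp
    then have "l = k"
      using r by (auto dest: injD)
    then show ?case
      using l gt[of k] by (auto simp: perturbed_simplex_def)
  qed
  moreover obtain l where "1 \<le> \<bar>x $ l - ?p None $ l\<bar>"
    using far[of None] by (auto simp: infnorm_cart_ge_iff)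
  ultimately show False
    using unused[of l None] last[of l] by force
qed

section \<open>Small maximal equilateral sets near the sup norm\<close>

lemma maximal_equilateral_near_infnorm:
  fixes N :: "real ^ 'n::finite \<Rightarrow> real"
  assumes N: "is_norm N" and b: "0 \<le> b" "b < 1 / 2"
    and upper: "\<And>x. N x \<le> infnorm x" and lower: "\<And>x. infnorm x \<le> (1 + b) * N x"
  obtains A where "maximal_equilateral N A" "finite A" "card A = CARD('n) + 1"
proof -
  obtain e :: "'n \<Rightarrow> nat" where e: "inj e" "range e = {i. i < CARD('n)}"
    using finite_imp_nat_seg_image_inj_on[of "UNIV :: 'n set"]
      ex_bij_betw_finite_nat[of "UNIV :: 'n set"]
    by (auto simp: bij_betw_def atLeast0LessThan lessThan_def)
  define r where "r = case_option (CARD('n)) e"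
  have e_less: "e k < CARD('n)" for k
    using e(2) by blast
  have r: "inj r"
    using e(1) e_less by (auto simp: inj_def r_def split: option.splits) (metis less_irrefl)+
  have last: "r (Some k) < r None" for k
    by (simp add: r_def e_less)
  have b': "b \<le> 1 / 2"
    using b by simp
  obtain \<epsilon> :: "real ^ ('n option) ^ 'n" where \<epsilon>: "\<And>k j. 0 \<le> \<epsilon> $ k $ j \<and> \<epsilon> $ k $ j \<le> b"
    and dist: "\<And>i j. i \<noteq> j \<Longrightarrow> N (perturbed_simplex r \<epsilon> i - perturbed_simplex r \<epsilon> j) = 1"
    using equilateral_perturbed_simplex_exists[OF N b(1) b' upper lower r last] by blast
  let ?p = "perturbed_simplex r \<epsilon>"
  have inj: "inj ?p"
    using dist is_normD(1)[OF N, of 0] by (intro injI) (metis diff_self zero_neq_one)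
  have "equilateral_with N 1 (range ?p)"
    by (auto simp: equilateral_with_def intro!: dist)
  then have "equilateral N (range ?p)"
    unfolding equilateral_def using zero_less_one by blast
  moreover have "\<not> (\<exists>A'. equilateral N A' \<and> range ?p \<subset> A')"
  proof
    assume "\<exists>A'. equilateral N A' \<and> range ?p \<subset> A'"
    then obtain A' l x where A': "equilateral_with N l A'" "range ?p \<subseteq> A'"
      and x: "x \<in> A'" "x \<notin> range ?p"
      unfolding equilateral_def by blast
    \<comment> \<open>There are at least two vertices, so the larger set has the same distance \<open>1\<close>.\<close>
    have "?p None \<noteq> ?p (Some undefined)"
      using inj by (auto dest: injD)
    then have "l = 1"
      using A' dist[of None "Some undefined"] unfolding equilateral_with_def by blast
    then have d: "N (x - ?p j) = 1" for j
      using A' x unfolding equilateral_with_def by blast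
    show False
      by (rule perturbed_simplex_not_extendable[OF b(2) \<epsilon> r last, of x])
        (use upper[of "x - ?p _"] lower[of "x - ?p _"] d in auto)
  qed
  ultimately have "maximal_equilateral N (range ?p)"
    by (simp add: maximal_equilateral_def)
  moreover have "card (range ?p) = CARD('n) + 1"
    using card_image[OF inj] by (simp add: card_UNIV_option)
  ultimately show thesis
    using that by simp
qed

lemma maximal_equilateral_pullback:
  assumes lin: "linear f" and bij: "bij f" and NM: "\<And>x. N x = M (f x)"
    and max: "maximal_equilateral M A"
  shows "maximal_equilateral N (f -` A)"
proof -
  have eq: "equilateral N S \<longleftrightarrow> equilateral M (f ` S)" for S
    using bij_is_inj[OF bij]
    by (auto simp: equilateral_def equilateral_with_def NM linear_diff[OF lin] inj_eq)
  have im: "f ` (f -` A) = A"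
    using bij by (simp add: bij_is_surj surj_image_vimage_eq)
  moreover have "A \<subset> f ` A'" if "f -` A \<subset> A'" for A'
    using that bij im by (metis bij_is_inj image_strict_mono subset_UNIV inj_on_subset)
  ultimately show ?thesis
    using max unfolding maximal_equilateral_def eq by metis
qed

section \<open>Maximal equilateral sets in the sup norm are not smaller\<close>

text \<open>
  Each \<open>s i\<close> describes a subcube of the sign cube: the sign vectors \<open>\<sigma>\<close> that agree with it wherever it
  is nonzero.  The hypotheses say that these subcubes partition the sign cube and that every
  coordinate is constrained by some of them.  In the language of logic, a formula whose clauses
  are pairwise in conflict and which is unsatisfiable has more clauses than variables; this is a
  case of Tarsi's lemma.

  If there were at most \<open>d\<close> subcubes, a nonzero vector \<open>a\<close> would have the same inner product \<open>c\<close> with all the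
  vectors \<open>s i\<close>.  Take any \<open>\<sigma>\<close> that has the signs of \<open>a\<close> on the support of \<open>a\<close>.  The subcube containing
  \<open>\<sigma>\<close> shows that \<open>c \<ge> 0\<close>, and once the signs on the support are reversed the
  same reasoning gives \<open>c \<le> 0\<close>.  So \<open>c = 0\<close>, all the terms vanish, and the subcube containing \<open>\<sigma>\<close> leaves
  the support of \<open>a\<close> unconstrained.  Since \<open>\<sigma>\<close> is arbitrary off the support, the subcubes of this kind
  fill the whole cube, and by disjointness there are no others.  But some subcube constrains a
  coordinate in the support.
\<close>

lemma card_gt_of_sign_partition:
  fixes s :: "'i \<Rightarrow> 'n::finite \<Rightarrow> real"
  assumes fin: "finite I"
    and signs: "\<And>i k. s i k \<in> {- 1, 0, 1}"
    and ex: "\<And>\<sigma>. (\<And>k. \<sigma> k \<in> {- 1, 1}) \<Longrightarrow> \<exists>i\<in>I. \<forall>k. s i k = 0 \<or> s i k = \<sigma> k"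
    and uniq: "\<And>i j. i \<in> I \<Longrightarrow> j \<in> I \<Longrightarrow> i \<noteq> j \<Longrightarrow> \<exists>k. s i k * s j k = - 1"
    and used: "\<And>k. \<exists>i\<in>I. s i k \<noteq> 0"
  shows "CARD('n) < card I"
proof (rule ccontr)
  assume "\<not> CARD('n) < card I"
  then obtain e :: "'i \<Rightarrow> 'n" where e: "inj_on e I"
    using card_le_inj[OF fin, of "UNIV :: 'n set"] by auto
  obtain a :: "real ^ 'n" and c :: real
    where a: "a \<noteq> 0" and c: "\<And>i. i \<in> I \<Longrightarrow> (\<Sum>k\<in>UNIV. s i k * a $ k) = c"
  proof -
    \<comment> \<open>The square matrix with rows \<open>s i\<close>, padded with zero rows: if it is singular, take a
      kernel vector and \<open>c = 0\<close>; if not, take a preimage of the all-ones vector and \<open>c = 1\<close>.\<close>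
    define F :: "real ^ 'n \<Rightarrow> real ^ 'n" where
      "F = (\<lambda>a. \<chi> l. if l \<in> e ` I then \<Sum>k\<in>UNIV. s (the_inv_into I e l) k * a $ k else 0)"
    have F: "F a $ e i = (\<Sum>k\<in>UNIV. s i k * a $ k)" if "i \<in> I" for a i
      using that by (simp add: F_def the_inv_into_f_f[OF e])
    have lin: "linear F"
      by (intro linearI) (auto simp: F_def vec_eq_iff algebra_simps sum.distrib sum_distrib_left)
    show thesis
    proof (cases "inj F")
      case True
      then obtain a where "F a = (\<chi> l. 1)"
        using linear_injective_imp_surjective[OF lin] by (metis surjD)
      moreover have "(\<chi> l. 1) \<noteq> (0 :: real ^ 'n)"
        by (simp add: vec_eq_iff)
      ultimately show thesis
        using that[of a 1] F[of _ a] linear_0[OF lin] by force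
    next
      case False
      then obtain a where "F a = 0" "a \<noteq> 0"
        using linear_injective_0[OF lin] by blast
      then show thesis
        using that[of a 0] F[of _ a] by simp
    qed
  qed
  have avoid: "\<exists>i\<in>I. (\<forall>k. s i k = 0 \<or> s i k = \<tau> k) \<and> (\<forall>k. a $ k \<noteq> 0 \<longrightarrow> s i k = 0)"
    if \<tau>: "\<And>k. \<tau> k \<in> {- 1, 1}" for \<tau>
  proof -
    define \<sigma> where "\<sigma> = (\<lambda>t k. if a $ k = 0 then \<tau> k else t * sgn (a $ k))"
    have \<sigma>: "\<sigma> t k \<in> {- 1, 1}" if "t \<in> {- 1, 1}" for t k
      using \<tau>[of k] that by (auto simp: \<sigma>_def sgn_if)
    obtain i where i: "i \<in> I" "\<And>k. s i k = 0 \<or> s i k = \<sigma> 1 k"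
      using ex[of "\<sigma> 1"] \<sigma> by blast
    obtain j where j: "j \<in> I" "\<And>k. s j k = 0 \<or> s j k = \<sigma> (- 1) k"
      using ex[of "\<sigma> (- 1)"] \<sigma> by blast
    have nonneg: "0 \<le> s i k * a $ k" for k
      using i(2)[of k] by (auto simp: \<sigma>_def sgn_if)
    have "s j k * a $ k \<le> 0" for k
      using j(2)[of k] by (auto simp: \<sigma>_def sgn_if)
    then have "c \<le> 0"
      unfolding c[OF j(1), symmetric] by (intro sum_nonpos)
    then have "(\<Sum>k\<in>UNIV. s i k * a $ k) = 0"
      unfolding c[OF i(1)] using sum_nonneg[of UNIV "\<lambda>k. s i k * a $ k"] nonneg c[OF i(1)] by simp
    then have zero: "s i k * a $ k = 0" for k
      using nonneg by (simp add: sum_nonneg_eq_0_iff)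
    then have "s i k = 0 \<or> s i k = \<tau> k" for k
      using i(2)[of k] by (auto simp: \<sigma>_def split: if_splits)
    then show ?thesis
      using i(1) zero by auto
  qed
  \<comment> \<open>Compare a subcube \<open>j\<close> that constrains a coordinate in the support of \<open>a\<close> with the
    subcube \<open>i\<close> that \<open>avoid\<close> provides for one of the vertices \<open>\<tau>\<close> of \<open>j\<close>.\<close>
  obtain k where k: "a $ k \<noteq> 0"
    using a by (auto simp: vec_eq_iff)
  obtain j where j: "j \<in> I" "s j k \<noteq> 0"
    using used by blast
  define \<tau> where "\<tau> = (\<lambda>k. if s j k = 0 then 1 else s j k)"
  have "\<tau> k \<in> {- 1, 1}" for k
    using signs[of j k] by (auto simp: \<tau>_def)
  from avoid[of \<tau>, OF this] obtain i where i: "i \<in> I" "\<And>k. s i k = 0 \<or> s i k = \<tau> k"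
    and off: "\<And>k. a $ k \<noteq> 0 \<Longrightarrow> s i k = 0"
    by blast
  have "i \<noteq> j"
    using off[OF k] j(2) by blast
  then obtain l where l: "s i l * s j l = - 1"
    using uniq i(1) j(1) by blast
  then have "s i l = s j l"
    using i(2)[of l] by (auto simp: \<tau>_def split: if_splits)
  then show False
    using l zero_le_square[of "s j l"] by simp
qed

text \<open>
  The subcube of a point \<open>p\<close> of \<open>A\<close> consists of the sign choices \<open>\<sigma>\<close> whose candidate point lies closer than
  \<open>l\<close> to \<open>p\<close>.  The candidate has coordinate \<open>lo k + l\<close> or \<open>hi k - l\<close>, depending on the sign \<open>\<sigma> k\<close>, and is
  at distance \<open>l\<close> from exactly those points that attain \<open>lo k\<close>, respectively \<open>hi k\<close>, for some \<open>k\<close>.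
\<close>

lemma infnorm_maximal_equilateral_card:
  fixes A :: "(real ^ 'n::finite) set"
  assumes max: "maximal_equilateral infnorm A" and fin: "finite A"
  shows "CARD('n) < card A"
proof -
  obtain l where l: "l > 0" and eq: "equilateral_with infnorm l A"
    using max by (auto simp: maximal_equilateral_def equilateral_def)
  have noext: False if "x \<notin> A" "\<And>y. y \<in> A \<Longrightarrow> infnorm (x - y) = l" for x
  proof -
    have "equilateral_with infnorm l (insert x A)"
      using that eq by (auto simp: equilateral_with_def infnorm_sub[of _ x])
    then have "equilateral infnorm (insert x A)"
      using l by (auto simp: equilateral_def)
    then show False
      using max \<open>x \<notin> A\<close> by (auto simp: maximal_equilateral_def)
  qed
  have ne: "A \<noteq> {}"
    using noext[of 0] by blast
  define lo hi where "lo = (\<lambda>k. Min ((\<lambda>p. p $ k) ` A))" and "hi = (\<lambda>k. Max ((\<lambda>p. p $ k) ` A))"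
  have bounds: "lo k \<le> p $ k" "p $ k \<le> hi k" if "p \<in> A" for p k
    using that fin by (auto simp: lo_def hi_def)
  have lo_in: "\<exists>p\<in>A. p $ k = lo k" and hi_in: "\<exists>p\<in>A. p $ k = hi k" for k
    using Min_in[of "(\<lambda>p. p $ k) ` A"] Max_in[of "(\<lambda>p. p $ k) ` A"] fin ne
    by (auto simp: lo_def hi_def image_iff eq_commute)
  have comp: "\<bar>p $ k - q $ k\<bar> \<le> l" if "p \<in> A" "q \<in> A" for p q k
  proof (cases "p = q")
    case False
    then have "infnorm (p - q) \<le> l"
      using eq that by (simp add: equilateral_with_def)
    then show ?thesis
      by (auto simp: infnorm_cart_le_iff)
  qed (use l in simp)
  have width: "hi k - lo k \<le> l" for k
    using lo_in[of k] hi_in[of k] comp by (metis abs_le_D1)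
  define s where "s = (\<lambda>p k. if p $ k = lo k then - 1 else if p $ k = hi k then 1 else 0 :: real)"
  have ex: "\<exists>p\<in>A. \<forall>k. (\<sigma> k = 1 \<longrightarrow> p $ k \<noteq> lo k) \<and> (\<sigma> k = - 1 \<longrightarrow> p $ k \<noteq> hi k)"
    if \<sigma>: "\<And>k. \<sigma> k \<in> {- 1, 1 :: real}" for \<sigma>
  proof (rule ccontr)
    assume "\<not> ?thesis"
    then have cover: "\<exists>k. (\<sigma> k = 1 \<and> p $ k = lo k) \<or> (\<sigma> k = - 1 \<and> p $ k = hi k)" if "p \<in> A" for p
      using that by blast
    define x where "x = (\<chi> k. if \<sigma> k = 1 then lo k + l else hi k - l)"
    have "infnorm (x - p) = l" if p: "p \<in> A" for p
    proof (rule antisym)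
      have "\<bar>(x - p) $ k\<bar> \<le> l" for k
        using bounds[OF p, of k] width[of k] by (auto simp: x_def)
      then show "infnorm (x - p) \<le> l"
        by (simp add: infnorm_cart_le_iff)
      obtain k where "(\<sigma> k = 1 \<and> p $ k = lo k) \<or> (\<sigma> k = - 1 \<and> p $ k = hi k)"
        using cover[OF p] by blast
      then have "l \<le> \<bar>(x - p) $ k\<bar>"
        by (auto simp: x_def)
      then show "l \<le> infnorm (x - p)"
        by (auto simp: infnorm_cart_ge_iff)
    qed
    moreover from this have "x \<notin> A"
      using l by (metis diff_self infnorm_0 less_irrefl)
    ultimately show False
      using noext by blast
  qed
  \<comment> \<open>In a coordinate where \<open>A\<close> is constant, every candidate would differ from all points by \<open>l\<close>.\<close>
  have proper: "lo k \<noteq> hi k" for k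
  proof
    assume "lo k = hi k"
    then have "p $ k = lo k" if "p \<in> A" for p
      using bounds[OF that, of k] by simp
    then show False
      using ex[of "\<lambda>_. 1"] by auto
  qed
  show ?thesis
  proof (rule card_gt_of_sign_partition[OF fin, of s])
    show "s p k \<in> {- 1, 0, 1}" for p k
      by (simp add: s_def)
    show "\<exists>p\<in>A. \<forall>k. s p k = 0 \<or> s p k = \<sigma> k" if \<sigma>: "\<And>k. \<sigma> k \<in> {- 1, 1}" for \<sigma>
    proof -
      obtain p where "p \<in> A"
        "\<And>k. (\<sigma> k = 1 \<longrightarrow> p $ k \<noteq> lo k) \<and> (\<sigma> k = - 1 \<longrightarrow> p $ k \<noteq> hi k)"
        using ex[of \<sigma>] \<sigma> by blast
      then show ?thesis
        using \<sigma> unfolding s_def by (metis empty_iff insert_iff)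
    qed
    show "\<exists>k. s p k * s q k = - 1" if pq: "p \<in> A" "q \<in> A" "p \<noteq> q" for p q
    proof -
      have "l \<le> infnorm (p - q)"
        using eq pq by (simp add: equilateral_with_def)
      then obtain k where k: "l \<le> \<bar>p $ k - q $ k\<bar>"
        by (auto simp: infnorm_cart_ge_iff)
      have "(p $ k = lo k \<and> q $ k = hi k) \<or> (p $ k = hi k \<and> q $ k = lo k)"
        using k width[of k] bounds[OF pq(1), of k] bounds[OF pq(2), of k] by linarith
      then show ?thesis
        using proper[of k] by (intro exI[of _ k]) (auto simp: s_def)
    qed
    show "\<exists>p\<in>A. s p k \<noteq> 0" for k
      using lo_in[of k] by (auto simp: s_def)
  qed
qed

section \<open>The Banach--Mazur distance\<close>

text \<open>
  The Banach--Mazur distance is an infimum of a set of reals and has an arbitrary value if that set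
  is empty.  To extract an isomorphism from an upper bound on the distance, one needs to know
  that the set is nonempty, that is, that a space of dimension \<open>d\<close> is isomorphic to
  \<open>\<ell>\<^sub>\<infinity>\<^sup>d\<close> with finite distortion.
\<close>

lemma linear_bij_to_cart_exists:
  assumes "dim (UNIV :: 'a::real_vector set) = CARD('n::finite)"
  obtains S :: "real ^ 'n::finite \<Rightarrow> 'a::real_vector" where "linear S" "bij S"
proof -
  obtain B :: "'a set" where B: "independent B" "span B = UNIV" "card B = CARD('n)"
    using basis_exists[of "UNIV :: 'a set"] assms by (metis top.extremum_uniqueI)
  have finB: "finite B"
    using B(3) by (metis card.infinite zero_less_card_finite less_irrefl)
  obtain g :: "'n \<Rightarrow> 'a" where g: "bij_betw g UNIV B"
    using finite_same_card_bij[of "UNIV :: 'n set" B] finB B(3) by auto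
  define S where "S = (\<lambda>x :: real ^ 'n. \<Sum>i\<in>UNIV. x $ i *\<^sub>R g i)"
  have reindex: "S x = (\<Sum>v\<in>B. x $ the_inv g v *\<^sub>R v)" for x
    unfolding S_def sum.reindex_bij_betw[OF g, symmetric]
    using the_inv_f_f[of g] bij_betw_imp_inj_on[OF g] by simp
  have lin: "linear S"
    by (intro linearI) (auto simp: S_def algebra_simps sum.distrib scaleR_sum_right)
  moreover have "inj S"
    unfolding linear_injective_0[OF lin]
  proof (intro allI impI)
    fix x assume "S x = 0"
    then have "x $ the_inv g v = 0" if "v \<in> B" for v
      using independentD[OF B(1) finB subset_refl _ that] reindex by metis
    then have "x $ i = 0" for i
      using the_inv_f_f[of g i] bij_betw_imp_inj_on[OF g] bij_betwE[OF g] by (metis UNIV_I)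
    then show "x = 0"
      by (simp add: vec_eq_iff)
  qed
  moreover have "surj S"
  proof -
    have "v \<in> range S" for v
    proof -
      have "v \<in> range (\<lambda>u. \<Sum>v\<in>B. u v *\<^sub>R v)"
        using B(2) span_finite[OF finB] by auto
      then obtain u where "v = (\<Sum>v\<in>B. u v *\<^sub>R v)" by blast
      then have "v = S (\<chi> i. u (g i))"
        unfolding S_def sum.reindex_bij_betw[OF g, symmetric] by simp
      then show ?thesis by blast
    qed
    then show ?thesis by blast
  qed
  ultimately show thesis
    using that by (simp add: bij_def)
qed

lemma linear_inv_bij:
  fixes f :: "'a::real_vector \<Rightarrow> 'b::real_vector"
  assumes "linear f" "bij f"
  shows "linear (inv f)"
proof (rule linearI)
  have fi: "f (inv f y) = y" for y
    using assms(2) by (simp add: bij_is_surj surj_f_inv_f)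
  have eqI: "x = y" if "f x = f y" for x y
    using that assms(2) by (simp add: bij_is_inj inj_eq)
  show "inv f (x + y) = inv f x + inv f y" for x y
    by (rule eqI) (simp add: fi linear_add[OF assms(1)])
  show "inv f (c *\<^sub>R x) = c *\<^sub>R inv f x" for c x
    by (rule eqI) (simp add: fi linear_scale[OF assms(1)])
qed

text \<open>
  The upper constant comes from expanding \<open>x\<close> in the standard basis, and gives continuity of \<open>N\<close>; the
  lower one is then the minimum of \<open>N\<close> on the compact sup-norm sphere.
\<close>

lemma is_norm_equiv_infnorm:
  fixes N :: "real ^ 'n::finite \<Rightarrow> real"
  assumes N: "is_norm N"
  obtains m C where "0 < m" "\<And>x. m * infnorm x \<le> N x" "\<And>x. N x \<le> C * infnorm x"
proof -
  define C where "C = (\<Sum>i\<in>UNIV. N (axis i 1))"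
  have le: "N x \<le> C * infnorm x" for x
  proof -
    have sub: "N (\<Sum>i\<in>I. h i) \<le> (\<Sum>i\<in>I. N (h i))" if "finite I" for I and h :: "'n \<Rightarrow> real ^ 'n"
      using that
    proof (induction I rule: finite_induct)
      case empty
      then show ?case using is_normD(1)[OF N, of 0] by simp
    next
      case (insert i I)
      then show ?case using is_normD(3)[OF N, of "h i" "\<Sum>i\<in>I. h i"] by simp
    qed
    have "N x = N (\<Sum>i\<in>UNIV. x $ i *\<^sub>R axis i 1)"
      using basis_expansion[of x] by (simp add: scalar_mult_eq_scaleR)
    also have "\<dots> \<le> (\<Sum>i\<in>UNIV. \<bar>x $ i\<bar> * N (axis i 1))"
      using sub[of UNIV "\<lambda>i. x $ i *\<^sub>R axis i 1"] is_normD(2)[OF N] by simp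
    also have "\<dots> \<le> (\<Sum>i\<in>UNIV. infnorm x * N (axis i 1))"
      using infnorm_cart_le_iff[of x "infnorm x"] is_norm_nonneg[OF N]
      by (intro sum_mono mult_right_mono) auto
    finally show ?thesis
      by (simp add: C_def sum_distrib_left[symmetric] mult.commute)
  qed
  define K where "K = {x :: real ^ 'n. infnorm x = 1}"
  have "infnorm (axis i 1 :: real ^ 'n) = 1" for i
    by (rule antisym) (auto simp: infnorm_cart_le_iff infnorm_cart_ge_iff axis_def intro!: exI[of _ i])
  then have "K \<noteq> {}"
    unfolding K_def by blast
  moreover have "compact K"
  proof -
    have "closed K"
      unfolding K_def by (intro closed_Collect_eq continuous_intros) 
    moreover have "norm x \<le> sqrt DIM(real ^ 'n)" if "x \<in> K" for x
      using norm_le_infnorm[of x] that by (simp add: K_def)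
    ultimately show ?thesis
      by (auto simp: compact_eq_bounded_closed bounded_iff)
  qed
  moreover have "continuous_on K N"
    using is_norm_continuous_on[OF N le] .
  ultimately obtain z where z: "z \<in> K" "\<And>x. x \<in> K \<Longrightarrow> N z \<le> N x"
    using continuous_attains_inf[of K N] by blast
  show thesis
  proof (rule that[of "N z" C])
    have "z \<noteq> 0"
      using z(1) by (auto simp: K_def infnorm_0)
    then show "0 < N z"
      using is_norm_nonneg[OF N, of z] is_normD(1)[OF N, of z] by linarith
    show "N x \<le> C * infnorm x" for x
      by (rule le)
    show "N z * infnorm x \<le> N x" for x
    proof (cases "x = 0")
      case True
      then show ?thesis using is_normD(1)[OF N, of 0] by (simp add: infnorm_0)
    next
      case False
      then have pos: "0 < infnorm x"
        by (simp add: infnorm_pos_lt)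
      have "(1 / infnorm x) *\<^sub>R x \<in> K"
        using pos by (simp add: K_def infnorm_mul)
      then have "N z \<le> (1 / infnorm x) * N x"
        using z(2) is_normD(2)[OF N] pos by fastforce
      then show ?thesis
        using pos by (simp add: field_simps)
    qed
  qed
qed

lemma banach_mazur_dist_lessD:
  fixes N :: "'a::real_vector \<Rightarrow> real"
  assumes N: "is_norm N" and dim: "dim (UNIV :: 'a set) = CARD('n::finite)"
    and less: "banach_mazur_dist N (infnorm :: real ^ 'n \<Rightarrow> real) < b"
  obtains c and T :: "'a \<Rightarrow> real ^ 'n" where "1 \<le> c" "c < b" "linear T" "bij T"
    "\<And>x. N x \<le> infnorm (T x)" "\<And>x. infnorm (T x) \<le> c * N x"
proof -
  let ?X = "{c. c \<ge> 1 \<and> (\<exists>T :: 'a \<Rightarrow> real ^ 'n. linear T \<and> bij T \<and>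
              (\<forall>x. N x \<le> infnorm (T x) \<and> infnorm (T x) \<le> c * N x))}"
  obtain S :: "real ^ 'n \<Rightarrow> 'a" where S: "linear S" "bij S"
    using linear_bij_to_cart_exists[OF dim] .
  obtain m C where m: "0 < m" "\<And>x. m * infnorm x \<le> N (S x)" and C: "\<And>x. N (S x) \<le> C * infnorm x"
    using is_norm_equiv_infnorm[OF is_norm_pullback[OF N S(1) bij_is_inj[OF S(2)]]] by blast
  \<comment> \<open>Rescaling by \<open>D\<close> turns the upper estimate into \<open>N x \<le> infnorm (T x)\<close>; the maximum with \<open>1\<close>
    makes \<open>D\<close> positive.\<close>
  define D where "D = max 1 C"
  define T where "T = (\<lambda>x. D *\<^sub>R inv S x)"
  have Si: "S (inv S x) = x" for x
    using S(2) by (simp add: bij_is_surj surj_f_inv_f)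
  have D: "1 \<le> D" "C \<le> D"
    by (auto simp: D_def)
  have "linear T"
    unfolding T_def using linear_inv_bij[OF S] by (rule linear_compose_scale_right)
  moreover have "bij T"
  proof (rule bijI')
    show "(T x = T y) = (x = y)" for x y
      using D Si by (auto simp: T_def) (metis Si)
    show "\<exists>x. y = T x" for y
      using D S(2) by (intro exI[of _ "S ((1 / D) *\<^sub>R y)"]) (simp add: T_def bij_is_inj inv_f_f)
  qed
  moreover have "N x \<le> infnorm (T x)" for x
    using C[of "inv S x"] D mult_right_mono[OF D(2) infnorm_pos_le[of "inv S x"]]
    by (simp add: Si T_def infnorm_mul)
  moreover have "infnorm (T x) \<le> max 1 (D / m) * N x" for x
  proof -
    have "infnorm (T x) \<le> (D / m) * N x"
      using m(1) m(2)[of "inv S x"] D mult_left_mono[of "m * infnorm (inv S x)" "N x" D]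
      by (simp add: Si T_def infnorm_mul field_simps)
    also have "\<dots> \<le> max 1 (D / m) * N x"
      using is_norm_nonneg[OF N, of x] by (intro mult_right_mono) auto
    finally show ?thesis .
  qed
  ultimately have "max 1 (D / m) \<in> ?X"
    by auto
  then have "?X \<noteq> {}"
    by blast
  then obtain c where "c \<in> ?X" "c < b"
    using less cInf_lessD[of ?X b] unfolding banach_mazur_dist_def by blast
  then show thesis
    using that by blast
qed

section \<open>The minimum size of a maximal equilateral set\<close>

theorem theorem3:
  shows "(\<forall>N :: 'a::real_vector \<Rightarrow> real.
            is_norm N \<and> dim (UNIV :: 'a set) = CARD('n::finite) \<and>
            banach_mazur_dist N (infnorm :: real ^ 'n \<Rightarrow> real) < 3 / 2
            \<longrightarrow> min_maximal_equilateral N \<le> CARD('n) + 1)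
         \<and> min_maximal_equilateral (infnorm :: real ^ 'n \<Rightarrow> real) = CARD('n) + 1"
proof (intro conjI allI impI)
  fix N :: "'a \<Rightarrow> real"
  assume "is_norm N \<and> dim (UNIV :: 'a set) = CARD('n) \<and>
    banach_mazur_dist N (infnorm :: real ^ 'n \<Rightarrow> real) < 3 / 2"
  then have N: "is_norm N" and dim: "dim (UNIV :: 'a set) = CARD('n)"
    and less: "banach_mazur_dist N (infnorm :: real ^ 'n \<Rightarrow> real) < 3 / 2"
    by auto
  obtain c and T :: "'a \<Rightarrow> real ^ 'n" where c: "1 \<le> c" "c < 3 / 2" and T: "linear T" "bij T"
    and NT: "\<And>x. N x \<le> infnorm (T x)" "\<And>x. infnorm (T x) \<le> c * N x"
    using banach_mazur_dist_lessD[OF N dim less] by blast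
  define M where "M = (\<lambda>y. N (inv T y))"
  have Ti: "T (inv T y) = y" "inv T (T x) = x" for x y
    using T(2) by (auto simp: bij_is_surj surj_f_inv_f bij_is_inj inv_f_f)
  have M: "is_norm M"
    unfolding M_def
    by (rule is_norm_pullback[OF N linear_inv_bij[OF T] bij_is_inj[OF bij_imp_bij_inv[OF T(2)]]])
  have up: "M y \<le> infnorm y" and low: "infnorm y \<le> (1 + (c - 1)) * M y" for y
    using NT[of "inv T y"] by (auto simp: M_def Ti)
  obtain A where A: "maximal_equilateral M A" "finite A" "card A = CARD('n) + 1"
    using maximal_equilateral_near_infnorm[OF M _ _ up low] c by auto
  have "maximal_equilateral N (T -` A)"
    by (rule maximal_equilateral_pullback[OF T _ A(1)]) (simp add: M_def Ti)
  moreover have "finite (T -` A)" "card (T -` A) = CARD('n) + 1"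
    using A(2,3) T(2) by (simp_all add: finite_vimageI bij_is_inj card_vimage_inj bij_is_surj)
  ultimately show "min_maximal_equilateral N \<le> CARD('n) + 1"
    unfolding min_maximal_equilateral_def by (intro Least_le) blast
next
  obtain A :: "(real ^ 'n) set" where
    "maximal_equilateral infnorm A" "finite A" "card A = CARD('n) + 1"
    using maximal_equilateral_near_infnorm[OF is_norm_infnorm, of 0] by auto
  then show "min_maximal_equilateral (infnorm :: real ^ 'n \<Rightarrow> real) = CARD('n) + 1"
    unfolding min_maximal_equilateral_def
    using infnorm_maximal_equilateral_card
    by (intro Least_equality) (auto simp: Suc_le_eq)
qed

end
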